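(* For any integer $m\ge2$, $$[\mathrm{O}(2)^-]\circledcirc[\mathbb{D}_m\oplus\mathbb{Z}_2^c]=\begin{cases}\{[\mathbb{1}],[\mathbb{Z}_2^-],[\mathbb{D}_2^z],[\mathbb{D}_m^z]\}&\text{if } m\text{ is even},\\ \{[\mathbb{1}],[\mathbb{Z}_2],[\mathbb{Z}_2^-],[\mathbb{D}_m^z]\}&\text{if } m\text{ is odd}.\end{cases}$$
   Context: $[K]$ is the conjugacy class of a subgroup $K$ in $\mathrm{O}(3)$, and the clips operation is $[H_1]\circledcirc[H_2]=\{[H_1\cap gH_2g^{-1}]:g\in\mathrm{O}(3)\}$. $(e_1,e_2,e_3)$ is the canonical basis of $\mathbb{R}^3$, $\mathbf{r}(n,\theta)$ is the rotation by angle $\theta$ about the axis directed by $n\neq0$. $\mathbb{1}=\{\mathrm{Id}\}$; $\mathbb{Z}_2^c=\{\pm\mathrm{Id}\}$; $H\oplus\mathbb{Z}_2^c=H\cup(-H)$ for $H\subset\mathrm{SO}(3)$; $\mathbb{Z}_k=\{\mathbf{r}(e_3,2j\pi/k):0\le j\le k-1\}$; $\mathbb{D}_k=\langle\mathbf{r}(e_3,2\pi/k),\mathbf{r}(e_1,\pi)\rangle$ for $k\ge2$; $\mathbb{Z}_2^-=\{\mathrm{Id},-\mathbf{r}(e_3,\pi)\}$; $\mathbb{D}_k^z=\mathbb{Z}_k\cup(-\mathbf{r}(e_1,\pi))\mathbb{Z}_k$ for $k\ge2$; $\mathrm{SO}(2)=\{\mathbf{r}(e_3,\theta):\theta\in[0,2\pi]\}$;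 $\mathrm{O}(2)^-=\mathrm{SO}(2)\cup(-\mathbf{r}(e_1,\pi))\mathrm{SO}(2)$. *)

theory Defs
  imports "HOL-Analysis.Analysis" "HOL-Algebra.Generated_Groups"
begin

definition O3 :: "(real^3^3) monoid" where
  "O3 = \<lparr>carrier = {A. orthogonal_matrix A}, mult = (**), one = mat 1\<rparr>"

abbreviation e1 :: "real^3" where "e1 \<equiv> axis 1 1"
abbreviation e3 :: "real^3" where "e3 \<equiv> axis 3 1"

text \<open>Rodrigues' formula; the axis vector \<open>n\<close> need not be a unit vector, and the rotation is
  counterclockwise as seen from the tip of \<open>n\<close>. Only used with \<open>n \<noteq> 0\<close>.\<close>

definition rot :: "real^3 \<Rightarrow> real \<Rightarrow> real^3^3" where
  "rot n \<theta> = matrix (\<lambda>v. let u = n /\<^sub>R norm n in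
     cos \<theta> *\<^sub>R v + sin \<theta> *\<^sub>R cross3 u v + ((1 - cos \<theta>) * (u \<bullet> v)) *\<^sub>R u)"

definition triv :: "(real^3^3) set" where
  "triv = {mat 1}"

definition plus_Z2c :: "(real^3^3) set \<Rightarrow> (real^3^3) set" where
  "plus_Z2c H = H \<union> uminus ` H"

definition Z_rot :: "nat \<Rightarrow> (real^3^3) set" where
  "Z_rot k = {rot e3 (2 * real j * pi / real k) | j. j < k}"

definition D_rot :: "nat \<Rightarrow> (real^3^3) set" where
  "D_rot k = generate O3 {rot e3 (2 * pi / real k), rot e1 pi}"

definition Z2_minus :: "(real^3^3) set" where
  "Z2_minus = {mat 1, - rot e3 pi}"

definition D_z :: "nat \<Rightarrow> (real^3^3) set" where
  "D_z k = Z_rot k \<union> ((- rot e1 pi) <#\<^bsub>O3\<^esub> Z_rot k)"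

definition SO2 :: "(real^3^3) set" where
  "SO2 = {rot e3 \<theta> | \<theta>. 0 \<le> \<theta> \<and> \<theta> \<le> 2 * pi}"

definition O2_minus :: "(real^3^3) set" where
  "O2_minus = SO2 \<union> ((- rot e1 pi) <#\<^bsub>O3\<^esub> SO2)"

definition conjg :: "real^3^3 \<Rightarrow> (real^3^3) set \<Rightarrow> (real^3^3) set" where
  "conjg g K = (g <#\<^bsub>O3\<^esub> K) #>\<^bsub>O3\<^esub> (inv\<^bsub>O3\<^esub> g)"

definition conj_class :: "(real^3^3) set \<Rightarrow> (real^3^3) set set" where
  "conj_class K = {conjg g K | g. g \<in> carrier O3}"

text \<open>The operation is defined on classes, so the representatives \<open>H1\<close>, \<open>H2\<close> range over the whole
  classes; \<open>clips_conj_class\<close> below gives the formula for fixed representatives.\<close>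

definition clips :: "(real^3^3) set set \<Rightarrow> (real^3^3) set set \<Rightarrow> (real^3^3) set set set" where
  "clips C1 C2 = {conj_class (H1 \<inter> conjg g H2) | H1 H2 g. H1 \<in> C1 \<and> H2 \<in> C2 \<and> g \<in> carrier O3}"

lemma group_O3: "group O3"
proof (rule groupI)
  fix x assume "x \<in> carrier O3"
  then show "\<exists>y\<in>carrier O3. y \<otimes>\<^bsub>O3\<^esub> x = \<one>\<^bsub>O3\<^esub>"
    by (intro bexI[of _ "transpose x"]) (auto simp: O3_def orthogonal_matrix_def)
qed (auto simp: O3_def orthogonal_matrix_mul orthogonal_matrix_id matrix_mul_assoc)

lemma conjg_image: "conjg g K = (\<lambda>x. g \<otimes>\<^bsub>O3\<^esub> x \<otimes>\<^bsub>O3\<^esub> inv\<^bsub>O3\<^esub> g) ` K"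
  by (auto simp: conjg_def l_coset_def r_coset_def)

lemma conjg_conjg:
  assumes "g \<in> carrier O3" "h \<in> carrier O3" "K \<subseteq> carrier O3"
  shows "conjg g (conjg h K) = conjg (g \<otimes>\<^bsub>O3\<^esub> h) K"
proof -
  interpret group O3 by (rule group_O3)
  show ?thesis
    unfolding conjg_image image_image
    by (rule image_cong) (use assms in \<open>auto simp: inv_mult_group m_assoc subset_iff\<close>)
qed

lemma conjg_one:
  assumes "K \<subseteq> carrier O3"
  shows "conjg \<one>\<^bsub>O3\<^esub> K = K"
proof -
  interpret group O3 by (rule group_O3)
  have "conjg \<one>\<^bsub>O3\<^esub> K = (\<lambda>x. x) ` K"
    unfolding conjg_image by (rule image_cong) (use assms in auto)
  then show ?thesis by simp
qed

lemma conjg_carrier: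
  assumes "g \<in> carrier O3" "K \<subseteq> carrier O3"
  shows "conjg g K \<subseteq> carrier O3"
proof -
  interpret group O3 by (rule group_O3)
  show ?thesis using assms by (auto simp: conjg_image)
qed

lemma conjg_Int:
  assumes "g \<in> carrier O3" "K \<subseteq> carrier O3" "L \<subseteq> carrier O3"
  shows "conjg g (K \<inter> L) = conjg g K \<inter> conjg g L"
proof -
  interpret group O3 by (rule group_O3)
  have "inj_on (\<lambda>x. g \<otimes>\<^bsub>O3\<^esub> x \<otimes>\<^bsub>O3\<^esub> inv\<^bsub>O3\<^esub> g) (carrier O3)"
    by (rule inj_onI) (use assms in auto)
  then show ?thesis unfolding conjg_image using assms by (intro inj_on_image_Int)
qed

lemma conj_class_conjg:
  assumes g: "g \<in> carrier O3" and K: "K \<subseteq> carrier O3"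
  shows "conj_class (conjg g K) = conj_class K"
proof -
  interpret group O3 by (rule group_O3)
  have "\<exists>h'\<in>carrier O3. conjg h (conjg g K) = conjg h' K" if "h \<in> carrier O3" for h
    by (rule bexI[of _ "h \<otimes>\<^bsub>O3\<^esub> g"]) (use that g K in \<open>auto simp: conjg_conjg\<close>)
  moreover have "\<exists>h'\<in>carrier O3. conjg h K = conjg h' (conjg g K)" if "h \<in> carrier O3" for h
    by (rule bexI[of _ "h \<otimes>\<^bsub>O3\<^esub> inv\<^bsub>O3\<^esub> g"])
      (use that g K in \<open>auto simp: conjg_conjg m_assoc\<close>)
  ultimately show ?thesis unfolding conj_class_def by blast
qed

lemma clips_conj_class:
  assumes K: "K \<subseteq> carrier O3" and L: "L \<subseteq> carrier O3"
  shows "clips (conj_class K) (conj_class L) =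
    {conj_class (K \<inter> conjg g L) | g. g \<in> carrier O3}" (is "?A = ?B")
proof
  interpret group O3 by (rule group_O3)
  show "?A \<subseteq> ?B"
  proof
    fix Y assume XA: "Y \<in> ?A"
    then obtain a b g where abg: "a \<in> carrier O3" "b \<in> carrier O3" "g \<in> carrier O3"
      and Y: "Y = conj_class (conjg a K \<inter> conjg g (conjg b L))"
      unfolding clips_def conj_class_def by blast
    define h where "h = inv\<^bsub>O3\<^esub> a \<otimes>\<^bsub>O3\<^esub> (g \<otimes>\<^bsub>O3\<^esub> b)"
    have h: "h \<in> carrier O3" using abg by (simp add: h_def)
    have "a \<otimes>\<^bsub>O3\<^esub> h = g \<otimes>\<^bsub>O3\<^esub> b" using abg by (simp add: h_def m_assoc[symmetric])
    then have "conjg a K \<inter> conjg g (conjg b L) = conjg a (K \<inter> conjg h L)"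
      using abg h K L by (simp add: conjg_Int conjg_conjg conjg_carrier)
    then have "Y = conj_class (K \<inter> conjg h L)"
      using Y abg K by (simp add: conj_class_conjg le_infI1)
    then show "Y \<in> ?B" using h by blast
  qed
  have "K \<in> conj_class K" "L \<in> conj_class L"
    unfolding conj_class_def using conjg_one[OF K] conjg_one[OF L] by (auto intro!: exI[of _ "\<one>\<^bsub>O3\<^esub>"])
  then show "?B \<subseteq> ?A" unfolding clips_def by blast
qed

end

theory Submission
  imports Defs
begin

text \<open>
  The group \<open>O2_minus\<close> is the full stabilizer of \<open>e3\<close> in the orthogonal group
  (\<open>O2_minus_stabilizer\<close>). Therefore its clips with the class of any set \<open>L\<close> of orthogonal matrices are
  the classes of the stabilizers in \<open>L\<close> of unit vectors (\<open>clips_O2_minus\<close>), and the problem is to find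
  the isotropy classes of the group \<open>plus_Z2c (D_rot m)\<close> acting on the sphere.

  That group consists of the rotations \<open>rot e3 t\<close>, the half-turns \<open>flip t\<close> about horizontal axes, and
  the negatives of both, where \<open>t\<close> runs over the multiples of \<open>2 * pi / m\<close> (\<open>D_rot_Z2c_eq\<close>). A vertical
  vector is fixed by exactly the elements of \<open>D_z m\<close> (\<open>stab_vertical\<close>). A vector off the vertical axis
  can be fixed, besides the identity, only by the reflection in the horizontal plane, the half-turn
  about the vector itself, and the reflection in the vertical plane through it. Which of these occur
  depends on whether the vector is horizontal, and on whether \<open>pi\<close>, \<open>2 * p\<close> and \<open>2 * p + pi\<close> are angles
  of the group, where \<open>p\<close> is the azimuth of the vector (\<open>stab_oblique\<close>).

  Now \<open>pi\<close> is an angle of the group exactly when \<open>m\<close> is even. In that case the conditions on \<open>2 * p\<close>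
  and \<open>2 * p + pi\<close> are equivalent and a horizontal vector on a half-turn axis has stabilizer of class
  \<open>D_z 2\<close>. If \<open>m\<close> is odd they exclude each other and the same vector has only its half-turn, giving
  the class of \<open>Z_rot 2\<close>. All other vectors off the vertical axis
  have a stabilizer that is trivial or generated by one reflection
  (\<open>isotropy_even\<close>, \<open>isotropy_odd\<close>).
\<close>

section \<open>Axis-preserving rotations as explicit matrices\<close>

lemma e3_vector: "e3 = vector [0, 0, 1]"
  by (simp add: vec_eq_iff forall_3 axis_def)

lemma vector_3_eq_iff:
  "(vector [a, b, c] :: 'a::zero^3) = vector [x, y, z] \<longleftrightarrow> a = x \<and> b = y \<and> c = z"
  by (simp add: vec_eq_iff forall_3)

lemma rot_e3_matrix:
  "rot e3 t = vector [vector [cos t, - sin t, 0], vector [sin t, cos t, 0], vector [0, 0, 1]]"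
proof -
  have "rot e3 t = matrix (\<lambda>v. cos t *\<^sub>R v + sin t *\<^sub>R cross3 e3 v + ((1 - cos t) * (e3 \<bullet> v)) *\<^sub>R e3)"
    unfolding rot_def by (simp add: Let_def)
  then show ?thesis
    by (simp add: matrix_def vec_eq_iff forall_3 cross3_simps axis_def inner_vec_def sum_3)
qed

text \<open>The half-turn about the horizontal axis at angle \<open>t / 2\<close> from \<open>e1\<close>. Indexing by the doubled angle
  turns products with rotations about \<open>e3\<close> into sums and differences of angles, and makes \<open>flip t\<close>
  depend only on \<open>t\<close> modulo full turns. Its negative is the reflection in the vertical plane
  perpendicular to that axis.\<close>

definition flip :: "real \<Rightarrow> real^3^3" where
  "flip t = vector [vector [cos t, sin t, 0], vector [sin t, - cos t, 0], vector [0, 0, - 1]]"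

lemma rot_e1_pi: "rot e1 pi = flip 0"
proof -
  have "rot e1 pi = matrix (\<lambda>v. cos pi *\<^sub>R v + sin pi *\<^sub>R cross3 e1 v + ((1 - cos pi) * (e1 \<bullet> v)) *\<^sub>R e1)"
    unfolding rot_def by (simp add: Let_def)
  then show ?thesis
    by (simp add: flip_def matrix_def vec_eq_iff forall_3 cross3_simps axis_def inner_vec_def sum_3)
qed

lemmas mat3_simps = vec_eq_iff forall_3 matrix_matrix_mult_def matrix_vector_mult_def
  transpose_def sum_3 mat_def

lemma rot_rot: "rot e3 a ** rot e3 b = rot e3 (a + b)"
  by (simp add: rot_e3_matrix mat3_simps cos_add sin_add algebra_simps)

lemma rot_flip: "rot e3 a ** flip b = flip (a + b)"
  by (simp add: rot_e3_matrix flip_def mat3_simps cos_add sin_add algebra_simps)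

lemma flip_rot: "flip a ** rot e3 b = flip (a - b)"
  by (simp add: rot_e3_matrix flip_def mat3_simps cos_diff sin_diff algebra_simps)

lemma flip_flip: "flip a ** flip b = rot e3 (a - b)"
  by (simp add: rot_e3_matrix flip_def mat3_simps cos_diff sin_diff algebra_simps)

lemma rot_zero: "rot e3 0 = mat 1"
  by (simp add: rot_e3_matrix mat3_simps)

lemma transpose_rot: "transpose (rot e3 a) = rot e3 (- a)"
  by (simp add: rot_e3_matrix mat3_simps)

lemma transpose_flip: "transpose (flip a) = flip a"
  by (simp add: flip_def mat3_simps)

lemma transpose_minus: "transpose (- A) = - transpose (A :: real^'n^'m)"
  by (simp add: transpose_def vec_eq_iff)

lemma minus_matrix_mult: "(- A) ** B = - (A ** (B :: real^'n^'m))"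
  by (simp add: matrix_matrix_mult_def vec_eq_iff sum_negf)

lemma matrix_mult_minus: "A ** (- B) = - (A ** (B :: real^'n^'m))"
  by (simp add: matrix_matrix_mult_def vec_eq_iff sum_negf)

lemma minus_matrix_vector_mult: "(- A) *v x = - (A *v (x :: real^'n))"
  by (simp add: matrix_vector_mult_def vec_eq_iff sum_negf)

lemma rot_vec: "rot e3 t *v vector [r * cos p, r * sin p, z] = vector [r * cos (t + p), r * sin (t + p), z]"
  by (simp add: rot_e3_matrix mat3_simps cos_add sin_add algebra_simps)

lemma flip_vec: "flip t *v vector [r * cos p, r * sin p, z] = vector [r * cos (t - p), r * sin (t - p), - z]"
  by (simp add: flip_def mat3_simps cos_diff sin_diff algebra_simps)

lemma rot_cong: "rot e3 (a + 2 * pi * of_int n) = rot e3 a"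
  using sin_cos_eq_iff[of "a + 2 * pi * of_int n" a] by (auto simp: rot_e3_matrix)

lemma flip_cong: "flip (a + 2 * pi * of_int n) = flip a"
  using sin_cos_eq_iff[of "a + 2 * pi * of_int n" a] by (auto simp: flip_def)

lemma orthogonal_rot: "orthogonal_matrix (rot e3 a)"
  by (simp add: orthogonal_matrix_def transpose_rot rot_rot rot_zero)

lemma orthogonal_flip: "orthogonal_matrix (flip a)"
  by (simp add: orthogonal_matrix_def transpose_flip flip_flip rot_zero)

lemma orthogonal_uminus: "orthogonal_matrix (- A) \<longleftrightarrow> orthogonal_matrix (A :: real^'n^'n)"
  by (simp add: orthogonal_matrix_def transpose_minus minus_matrix_mult matrix_mult_minus)

section \<open>Clips with the stabilizer of a vector\<close>

lemma carrier_O3: "carrier O3 = {A. orthogonal_matrix A}"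
  by (simp add: O3_def)

lemma mult_O3: "A \<otimes>\<^bsub>O3\<^esub> B = A ** B"
  by (simp add: O3_def)

lemma one_O3: "\<one>\<^bsub>O3\<^esub> = mat 1"
  by (simp add: O3_def)

lemma inv_O3:
  assumes "orthogonal_matrix g" shows "inv\<^bsub>O3\<^esub> g = transpose g"
proof -
  interpret group O3 by (rule group_O3)
  show ?thesis
    by (rule inv_equality)
      (use assms in \<open>auto simp: carrier_O3 mult_O3 one_O3 orthogonal_matrix_def\<close>)
qed

lemma conjg_transpose:
  "orthogonal_matrix g \<Longrightarrow> conjg g K = (\<lambda>A. g ** A ** transpose g) ` K"
  by (simp add: conjg_image inv_O3 mult_O3)

lemma conj_class_eqI:
  assumes "orthogonal_matrix g" "K \<subseteq> carrier O3" "L = (\<lambda>A. g ** A ** transpose g) ` K"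
  shows "conj_class L = conj_class K"
  using conj_class_conjg[of g K] assms by (simp add: conjg_transpose carrier_O3)

lemma SO2_eq_range: "SO2 = range (rot e3)"
proof -
  have "rot e3 t \<in> SO2" for t
  proof -
    obtain s where s: "0 \<le> s" "s < 2 * pi" "cos t = cos s" "sin t = sin s"
      using sincos_total_2pi[OF sin_cos_squared_add2[of t]] by metis
    have "rot e3 t = rot e3 s" using s by (simp add: rot_e3_matrix)
    then show ?thesis unfolding SO2_def using s by (intro CollectI exI[of _ s]) auto
  qed
  then show ?thesis by (auto simp: SO2_def)
qed

lemma O2_minus_eq: "O2_minus = range (rot e3) \<union> range (\<lambda>t. - flip t)"
proof -
  have "(- rot e1 pi) <#\<^bsub>O3\<^esub> SO2 = range (\<lambda>t. - flip (- t))"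
    by (auto simp: l_coset_def SO2_eq_range mult_O3 rot_e1_pi minus_matrix_mult flip_rot)
  also have "\<dots> = range (\<lambda>t. - flip t)"
    using surj_uminus[where 'a = real] image_image[of "\<lambda>t. - flip t" uminus UNIV] by metis
  finally show ?thesis by (simp add: O2_minus_def SO2_eq_range)
qed

text \<open>An orthogonal matrix fixing \<open>e3\<close> has third column \<open>e3\<close>, and third row \<open>e3\<close> because its transpose
  fixes \<open>e3\<close> as well. What remains is an orthogonal 2 by 2 block of determinant \<open>k = \<plusminus>1\<close>: a rotation or
  a reflection of the horizontal plane.\<close>

lemma O2_minus_stabilizer: "O2_minus = {A. orthogonal_matrix A \<and> A *v e3 = e3}"
proof (intro equalityI subsetI)
  fix A assume "A \<in> O2_minus"
  moreover have "rot e3 t *v e3 = e3" "(- flip t) *v e3 = e3" for t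
    unfolding rot_e3_matrix flip_def
    by (simp_all add: e3_vector vec_eq_iff forall_3 matrix_vector_mult_def sum_3)
  ultimately show "A \<in> {A. orthogonal_matrix A \<and> A *v e3 = e3}"
    by (auto simp: O2_minus_eq orthogonal_rot orthogonal_flip orthogonal_uminus)
next
  fix A :: "real^3^3" assume "A \<in> {A. orthogonal_matrix A \<and> A *v e3 = e3}"
  then have A: "orthogonal_matrix A" and fix3: "A *v e3 = e3" by auto
  have "transpose A *v e3 = transpose A *v (A *v e3)" by (simp add: fix3)
  also have "\<dots> = e3" using A by (simp add: matrix_vector_mul_assoc orthogonal_matrix_def)
  finally have fix3': "transpose A *v e3 = e3" .
  have col: "A$1$3 = 0" "A$2$3 = 0" "A$3$3 = 1"
    using fix3 by (simp_all add: e3_vector vec_eq_iff forall_3 matrix_vector_mult_def sum_3)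
  have row: "A$3$1 = 0" "A$3$2 = 0"
    using fix3' by (simp_all add: e3_vector vec_eq_iff forall_3 matrix_vector_mult_def transpose_def sum_3)
  have "transpose A ** A = mat 1" using A by (simp add: orthogonal_matrix_def)
  then have o: "(A$1$1)^2 + (A$2$1)^2 = 1" "(A$1$2)^2 + (A$2$2)^2 = 1"
    "A$1$1 * A$1$2 + A$2$1 * A$2$2 = 0"
    using row by (simp_all add: mat3_simps power2_eq_square)
  obtain t where t: "A$1$1 = cos t" "A$2$1 = sin t"
    using sincos_total_2pi[OF o(1)] by metis
  \<comment> \<open>the determinant of the upper left block\<close>
  define k where "k = A$2$2 * cos t - A$1$2 * sin t"
  have b: "A$1$2 = - k * sin t" "A$2$2 = k * cos t"
  proof -
    have perp: "cos t * A$1$2 = - (sin t * A$2$2)" and perp': "sin t * A$2$2 = - (cos t * A$1$2)"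
      using o(3) t by simp_all
    have "k * sin t = cos t * (sin t * A$2$2) - A$1$2 * (sin t)^2"
      by (simp add: k_def algebra_simps power2_eq_square)
    also have "\<dots> = - A$1$2 * ((sin t)^2 + (cos t)^2)"
      by (simp only: perp' ring_distribs power2_eq_square) (simp add: mult_ac)
    finally show "A$1$2 = - k * sin t" by simp
    have "k * cos t = A$2$2 * (cos t)^2 - (cos t * A$1$2) * sin t"
      by (simp add: k_def algebra_simps power2_eq_square)
    also have "\<dots> = A$2$2 * ((sin t)^2 + (cos t)^2)"
      by (simp only: perp ring_distribs power2_eq_square) (simp add: mult_ac)
    finally show "A$2$2 = k * cos t" by simp
  qed
  have "(k * sin t)^2 + (k * cos t)^2 = 1" using o(2) b by simp
  then have "k^2 * ((sin t)^2 + (cos t)^2) = 1" by (simp only: power_mult_distrib ring_distribs)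
  then have "k = 1 \<or> k = - 1" by (simp add: power2_eq_1_iff)
  then show "A \<in> O2_minus"
  proof
    assume "k = 1"
    then have "A = rot e3 t" using col row t b by (simp add: rot_e3_matrix mat3_simps)
    then show ?thesis by (simp add: O2_minus_eq)
  next
    assume "k = - 1"
    then have "A = - flip (t + pi)" using col row t b by (simp add: flip_def mat3_simps)
    then show ?thesis by (simp add: O2_minus_eq)
  qed
qed

abbreviation stab :: "(real^3^3) set \<Rightarrow> real^3 \<Rightarrow> (real^3^3) set" where
  "stab L u \<equiv> {A \<in> L. A *v u = u}"

lemma O2_minus_Int_conjg:
  assumes g: "orthogonal_matrix g" and L: "L \<subseteq> carrier O3"
  shows "O2_minus \<inter> conjg g L = conjg g (stab L (transpose g *v e3))"
proof -
  have gg: "g ** transpose g = mat 1" "transpose g ** g = mat 1"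
    using g by (auto simp: orthogonal_matrix_def)
  have "orthogonal_matrix (g ** A ** transpose g)" if "A \<in> L" for A
    using that L g by (auto simp: carrier_O3 intro!: orthogonal_matrix_mul orthogonal_matrix_transpose[THEN iffD2])
  moreover have "(g ** A ** transpose g) *v e3 = e3 \<longleftrightarrow> A *v (transpose g *v e3) = transpose g *v e3" for A
  proof -
    have "g *v x = e3 \<longleftrightarrow> x = transpose g *v e3" for x
      by (metis gg matrix_vector_mul_assoc matrix_vector_mul_lid)
    then show ?thesis by (simp add: matrix_vector_mul_assoc[symmetric])
  qed
  ultimately show ?thesis
    using g by (auto simp: conjg_transpose O2_minus_stabilizer)
qed

text \<open>Moving \<open>L\<close> by \<open>g\<close> against the stabilizer of \<open>e3\<close> amounts, up to conjugation, to replacing \<open>e3\<close> by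
  \<open>transpose g *v e3\<close>, and the orthogonal group acts transitively on the unit sphere.\<close>

lemma clips_O2_minus:
  assumes L: "L \<subseteq> carrier O3"
  shows "clips (conj_class O2_minus) (conj_class L) = (\<lambda>u. conj_class (stab L u)) ` {u. norm u = 1}"
proof -
  have O: "O2_minus \<subseteq> carrier O3" by (auto simp: O2_minus_stabilizer carrier_O3)
  have *: "conj_class (O2_minus \<inter> conjg g L) = conj_class (stab L (transpose g *v e3))"
    if "orthogonal_matrix g" for g
    unfolding O2_minus_Int_conjg[OF that L]
    by (rule conj_class_conjg) (use that L in \<open>auto simp: carrier_O3\<close>)
  have 1: "norm (transpose g *v e3) = 1" if "orthogonal_matrix g" for g :: "real^3^3"
    using that orthogonal_transformation_norm[of "(*v) (transpose g)" e3]
    by (simp add: orthogonal_transformation_matrix)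
  have 2: "\<exists>g. orthogonal_matrix g \<and> transpose g *v e3 = u" if u: "norm u = 1" for u
  proof -
    obtain f where f: "orthogonal_transformation f" "f e3 = u"
      using orthogonal_transformation_exists_1[OF norm_axis_1 u] by blast
    then show ?thesis
      by (intro exI[of _ "transpose (matrix f)"])
        (auto simp: orthogonal_transformation_matrix transpose_transpose matrix_works)
  qed
  show ?thesis
    unfolding clips_conj_class[OF O L] using * 1 2 by (fastforce simp: carrier_O3)
qed

section \<open>The elements of the dihedral groups\<close>

text \<open>The angles of the rotations in \<open>Z_rot m\<close>, taken over all integer multiples so that they form a
  subgroup of the reals, which contains the full turns when \<open>m\<close> is positive.\<close>

definition angles :: "nat \<Rightarrow> real set" where
  "angles m = range (\<lambda>j::int. 2 * pi * j / m)"

lemma angles_add: "a \<in> angles m \<Longrightarrow> b \<in> angles m \<Longrightarrow> a + b \<in> angles m"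
proof -
  assume "a \<in> angles m" "b \<in> angles m"
  then obtain i j :: int where "a = 2 * pi * i / m" "b = 2 * pi * j / m" by (auto simp: angles_def)
  then have "a + b = 2 * pi * (i + j) / m" by (simp add: ring_distribs add_divide_distrib)
  then show ?thesis unfolding angles_def by blast
qed

lemma angles_uminus: "a \<in> angles m \<Longrightarrow> - a \<in> angles m"
proof -
  assume "a \<in> angles m"
  then obtain i :: int where "a = 2 * pi * i / m" by (auto simp: angles_def)
  then have "- a = 2 * pi * (- i) / m" by simp
  then show ?thesis unfolding angles_def by blast
qed

lemma angles_diff: "a \<in> angles m \<Longrightarrow> b \<in> angles m \<Longrightarrow> a - b \<in> angles m"
  using angles_add[of a m "- b"] angles_uminus[of b m] by simp

lemma angles_full_turns:
  assumes "m > 0" shows "2 * pi * of_int n \<in> angles m"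
proof -
  have "2 * pi * of_int n = 2 * pi * (n * int m) / m" using assms by simp
  then show ?thesis unfolding angles_def by blast
qed

lemma angles_cong:
  assumes "m > 0" shows "a + 2 * pi * of_int n \<in> angles m \<longleftrightarrow> a \<in> angles m"
  using angles_add[of a m "2 * pi * of_int n"] angles_diff[of "a + 2 * pi * of_int n" m "2 * pi * of_int n"]
    angles_full_turns[OF assms] by auto

lemma zero_in_angles: "0 \<in> angles m"
  unfolding angles_def by (rule range_eqI[of _ _ 0]) simp

text \<open>The parity of \<open>m\<close> enters the classification through this fact alone: it decides whether the
  half-turn about \<open>e3\<close>, and hence the horizontal reflection, belongs to the group.\<close>

lemma pi_in_angles_iff:
  assumes "m > 0" shows "pi \<in> angles m \<longleftrightarrow> even m"
proof -
  have "pi = 2 * pi * j / m \<longleftrightarrow> int m = 2 * j" for j :: int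
  proof -
    have "pi = 2 * pi * j / m \<longleftrightarrow> real_of_int (int m) = real_of_int (2 * j)"
      using assms by (simp add: field_simps)
    then show ?thesis by (simp only: of_int_eq_iff)
  qed
  then have "pi \<in> angles m \<longleftrightarrow> (\<exists>j. int m = 2 * j)" by (auto simp: angles_def)
  also have "\<dots> \<longleftrightarrow> even (int m)" by (auto simp: dvd_def)
  finally show ?thesis by simp
qed

text \<open>Provides an azimuth away from the axes and mirror planes of the group when \<open>m\<close> is even.\<close>

lemma half_step_notin_angles:
  assumes "m > 0" shows "pi / m \<notin> angles m"
proof
  assume "pi / m \<in> angles m"
  then obtain j :: int where "pi / m = 2 * pi * j / m" by (auto simp: angles_def)
  then have "real_of_int (2 * j) = real_of_int 1" using assms by (simp add: field_simps)
  then have "2 * j = 1" by (simp only: of_int_eq_iff)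
  then show False by presburger
qed

lemma Z_rot_eq:
  assumes "m > 0" shows "Z_rot m = rot e3 ` angles m"
proof
  show "Z_rot m \<subseteq> rot e3 ` angles m"
  proof
    fix A assume "A \<in> Z_rot m"
    then obtain j :: nat where "A = rot e3 (2 * real j * pi / real m)" by (auto simp: Z_rot_def)
    then have "A = rot e3 (2 * pi * int j / real m)" by (simp add: mult_ac)
    then show "A \<in> rot e3 ` angles m" unfolding angles_def by blast
  qed
next
  show "rot e3 ` angles m \<subseteq> Z_rot m"
  proof
    fix A assume "A \<in> rot e3 ` angles m"
    then obtain j :: int where A: "A = rot e3 (2 * pi * j / m)" by (auto simp: angles_def)
    define k where "k = nat (j mod int m)"
    have k: "k < m" "int k = j mod int m" using assms by (simp_all add: k_def nat_less_iff)
    have "j = int k + int m * (j div int m)" using k by simp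
    then have "real_of_int j = real k + real m * (j div int m)"
      by (metis of_int_add of_int_mult of_int_of_nat_eq)
    then have "2 * pi * j / m = 2 * real k * pi / real m + 2 * pi * (j div int m)"
      using assms by (simp add: field_simps)
    then have "A = rot e3 (2 * real k * pi / real m)" by (simp add: A rot_cong)
    then show "A \<in> Z_rot m" using k by (auto simp: Z_rot_def)
  qed
qed

lemma D_rot_eq:
  assumes "m > 0" shows "D_rot m = rot e3 ` angles m \<union> flip ` angles m" (is "_ = ?D")
proof
  interpret group O3 by (rule group_O3)
  let ?r = "rot e3 (2 * pi / real m)" and ?s = "rot e1 pi"
  have step: "2 * pi / real m \<in> angles m"
    unfolding angles_def by (rule range_eqI[of _ _ 1]) simp
  have "subgroup ?D O3"
  proof (rule subgroupI)
    fix A B assume "A \<in> ?D" "B \<in> ?D"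
    then show "A \<otimes>\<^bsub>O3\<^esub> B \<in> ?D"
      by (auto simp: mult_O3 rot_rot rot_flip flip_rot flip_flip intro!: imageI angles_add angles_diff)
  next
    fix A assume "A \<in> ?D"
    then show "inv\<^bsub>O3\<^esub> A \<in> ?D"
      by (auto simp: inv_O3 orthogonal_rot orthogonal_flip transpose_rot transpose_flip
          intro!: imageI angles_uminus)
  qed (use zero_in_angles in \<open>auto simp: carrier_O3 orthogonal_rot orthogonal_flip\<close>)
  moreover have "{?r, ?s} \<subseteq> ?D"
    using step zero_in_angles[of m] by (auto simp: rot_e1_pi)
  ultimately show "D_rot m \<subseteq> ?D"
    unfolding D_rot_def by (intro generate_subgroup_incl)
  have pow: "rot e3 (2 * real j * pi / real m) \<in> D_rot m" for j :: nat
  proof (induction j)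
    case 0
    then show ?case
      using generate.one[of O3] by (simp add: D_rot_def rot_zero one_O3)
  next
    case (Suc j)
    have "?r \<in> D_rot m" unfolding D_rot_def by (rule generate.incl) simp
    then have "rot e3 (2 * real j * pi / real m) \<otimes>\<^bsub>O3\<^esub> ?r \<in> D_rot m"
      using Suc unfolding D_rot_def by (rule generate.eng[rotated])
    then show ?case by (simp add: mult_O3 rot_rot add_divide_distrib algebra_simps)
  qed
  then have rots: "rot e3 ` angles m \<subseteq> D_rot m"
    unfolding Z_rot_eq[OF assms, symmetric] by (auto simp: Z_rot_def)
  moreover have "flip t \<in> D_rot m" if "t \<in> angles m" for t
  proof -
    have "?s \<in> D_rot m" unfolding D_rot_def by (rule generate.incl) simp
    moreover have "rot e3 t \<in> D_rot m" using rots that by blast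
    ultimately have "rot e3 t \<otimes>\<^bsub>O3\<^esub> ?s \<in> D_rot m"
      unfolding D_rot_def by (intro generate.eng)
    then show ?thesis by (simp add: mult_O3 rot_e1_pi rot_flip)
  qed
  ultimately show "?D \<subseteq> D_rot m" by blast
qed

lemma D_z_eq:
  assumes "m > 0" shows "D_z m = rot e3 ` angles m \<union> (\<lambda>t. - flip t) ` angles m"
proof -
  have "(- rot e1 pi) <#\<^bsub>O3\<^esub> Z_rot m = (\<lambda>t. - flip t) ` uminus ` angles m"
    by (auto simp: l_coset_def Z_rot_eq[OF assms] mult_O3 rot_e1_pi minus_matrix_mult flip_rot image_image)
  moreover have "uminus ` angles m = angles m"
    by (force simp: image_iff intro: angles_uminus bexI[of _ "- _"])
  ultimately show ?thesis by (simp add: D_z_def Z_rot_eq[OF assms])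
qed

lemma D_rot_Z2c_eq:
  assumes "m > 0"
  shows "plus_Z2c (D_rot m) = rot e3 ` angles m \<union> flip ` angles m
    \<union> (\<lambda>t. - rot e3 t) ` angles m \<union> (\<lambda>t. - flip t) ` angles m"
  by (simp add: plus_Z2c_def D_rot_eq[OF assms] image_Un image_image Un_assoc)

section \<open>Stabilizers of unit vectors\<close>

lemma stab_vertical:
  assumes m: "m > 0" and z: "z \<noteq> 0"
  shows "stab (plus_Z2c (D_rot m)) (vector [0, 0, z]) = D_z m"
proof -
  have "rot e3 t *v vector [0, 0, z] = vector [0, 0, z]"
    "flip t *v vector [0, 0, z] = vector [0, 0, - z]" for t
    using rot_vec[of t 0 0 z] flip_vec[of t 0 0 z] by simp_all
  moreover have "- vector [0, 0, w] = (vector [0, 0, - w] :: real^3)" for w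
    by (simp add: vec_eq_iff forall_3)
  ultimately show ?thesis
    using z by (auto simp: D_rot_Z2c_eq[OF m] D_z_eq[OF m] minus_matrix_vector_mult vector_3_eq_iff)
qed

lemma polar_eq_iff:
  assumes "r > (0::real)"
  shows "r * cos a = r * cos b \<and> r * sin a = r * sin b \<longleftrightarrow> (\<exists>n::int. a = b + 2 * pi * n)"
  using assms sin_cos_eq_iff[of a b] by auto

text \<open>In cylindrical coordinates, \<open>rot e3 t\<close> sends the azimuth \<open>p\<close> to \<open>t + p\<close>, \<open>flip t\<close> sends it to \<open>t - p\<close>
  and negates the height, and \<open>- mat 1\<close> shifts the azimuth by \<open>pi\<close> and negates the height. Away from
  the vertical axis a vector determines its azimuth up to full turns.\<close>

lemma fixed_by_iff:
  assumes r: "r > 0" and u: "u = vector [r * cos p, r * sin p, z]"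
  shows "rot e3 t *v u = u \<longleftrightarrow> (\<exists>n::int. t = 2 * pi * n)"
    and "(- rot e3 t) *v u = u \<longleftrightarrow> z = 0 \<and> (\<exists>n::int. t = pi + 2 * pi * n)"
    and "flip t *v u = u \<longleftrightarrow> z = 0 \<and> (\<exists>n::int. t = 2 * p + 2 * pi * n)"
    and "(- flip t) *v u = u \<longleftrightarrow> (\<exists>n::int. t = 2 * p + pi + 2 * pi * n)"
proof -
  have minus: "- vector [r * cos a, r * sin a, w] = (vector [r * cos (a - pi), r * sin (a - pi), - w] :: real^3)" for a w
    by (simp add: vec_eq_iff forall_3)
  have eq: "vector [r * cos a, r * sin a, w] = u \<longleftrightarrow> w = z \<and> (\<exists>n::int. a = p + 2 * pi * n)" for a w
    using polar_eq_iff[OF r, of a p] by (auto simp: u vector_3_eq_iff)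
  show "rot e3 t *v u = u \<longleftrightarrow> (\<exists>n::int. t = 2 * pi * n)"
    unfolding u rot_vec unfolding u[symmetric] eq by simp
  show "(- rot e3 t) *v u = u \<longleftrightarrow> z = 0 \<and> (\<exists>n::int. t = pi + 2 * pi * n)"
    unfolding u minus_matrix_vector_mult rot_vec minus unfolding u[symmetric] eq
    by (auto simp: algebra_simps)
  show "flip t *v u = u \<longleftrightarrow> z = 0 \<and> (\<exists>n::int. t = 2 * p + 2 * pi * n)"
    unfolding u flip_vec unfolding u[symmetric] eq by (auto simp: algebra_simps)
  show "(- flip t) *v u = u \<longleftrightarrow> (\<exists>n::int. t = 2 * p + pi + 2 * pi * n)"
    unfolding u minus_matrix_vector_mult flip_vec minus unfolding u[symmetric] eq
    by (auto simp: algebra_simps)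
qed

text \<open>The stabilizer in \<open>plus_Z2c (D_rot m)\<close> of a vector off the vertical axis with azimuth \<open>p\<close>, where
  \<open>horizontal\<close> says whether the height vanishes. The three optional elements are the reflection in the
  horizontal plane, the half-turn about the axis through azimuth \<open>p\<close>, and the reflection in the
  vertical plane through azimuth \<open>p\<close>.\<close>

definition isotropy :: "nat \<Rightarrow> bool \<Rightarrow> real \<Rightarrow> (real^3^3) set" where
  "isotropy m horizontal p =
    {mat 1} \<union> (if horizontal \<and> pi \<in> angles m then {- rot e3 pi} else {})
      \<union> (if horizontal \<and> 2 * p \<in> angles m then {flip (2 * p)} else {})
      \<union> (if 2 * p + pi \<in> angles m then {- flip (2 * p + pi)} else {})"

text \<open>In each of the four families of the group, fixing the vector determines the angle up to full
  turns, and these change neither the matrix nor membership in \<open>angles m\<close>; hence each family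
  contributes at most one element.\<close>

lemma stab_oblique:
  assumes m: "m > 0" and r: "r > 0"
  shows "stab (plus_Z2c (D_rot m)) (vector [r * cos p, r * sin p, z]) = isotropy m (z = 0) p"
    (is "stab ?G ?u = _")
proof -
  note fixed = fixed_by_iff[OF r refl]
  have R: "{A \<in> rot e3 ` angles m. A *v ?u = ?u} = {mat 1}"
    using angles_full_turns[OF m] rot_cong[of 0] zero_in_angles[of m]
    by (auto simp: fixed rot_zero image_iff intro!: bexI[of _ 0])
  have "{A \<in> (\<lambda>t. - rot e3 t) ` angles m. A *v ?u = ?u} =
      (if z = 0 \<and> pi \<in> angles m then {- rot e3 pi} else {})"
    using angles_cong[OF m, of pi] by (auto simp: fixed rot_cong image_iff intro!: bexI[of _ pi] exI[of _ 0])
  moreover have "{A \<in> flip ` angles m. A *v ?u = ?u} =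
      (if z = 0 \<and> 2 * p \<in> angles m then {flip (2 * p)} else {})"
    using angles_cong[OF m, of "2 * p"]
    by (auto simp: fixed flip_cong image_iff intro!: bexI[of _ "2 * p"] exI[of _ 0])
  moreover have "{A \<in> (\<lambda>t. - flip t) ` angles m. A *v ?u = ?u} =
      (if 2 * p + pi \<in> angles m then {- flip (2 * p + pi)} else {})"
    using angles_cong[OF m, of "2 * p + pi"]
    by (auto simp: fixed flip_cong image_iff intro!: bexI[of _ "2 * p + pi"] exI[of _ 0])
  moreover have "stab ?G ?u = {A \<in> rot e3 ` angles m. A *v ?u = ?u} \<union> {A \<in> (\<lambda>t. - rot e3 t) ` angles m. A *v ?u = ?u}
     \<union> {A \<in> flip ` angles m. A *v ?u = ?u} \<union> {A \<in> (\<lambda>t. - flip t) ` angles m. A *v ?u = ?u}"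
    unfolding D_rot_Z2c_eq[OF m] by blast
  ultimately show ?thesis using R by (simp add: isotropy_def)
qed

lemma norm_polar: "norm (vector [r * cos p, r * sin p, z] :: real^3) = 1 \<longleftrightarrow> r\<^sup>2 + z\<^sup>2 = 1"
proof -
  have "(r * cos p)\<^sup>2 + (r * sin p)\<^sup>2 = r\<^sup>2"
    by (simp only: power_mult_distrib distrib_left[symmetric] sin_cos_squared_add2 mult_1_right)
  moreover have "(norm (vector [r * cos p, r * sin p, z] :: real^3))\<^sup>2 = (r * cos p)\<^sup>2 + (r * sin p)\<^sup>2 + z\<^sup>2"
    unfolding power2_norm_eq_inner by (simp add: inner_vec_def sum_3 power2_eq_square)
  ultimately have "r\<^sup>2 + z\<^sup>2 = (norm (vector [r * cos p, r * sin p, z] :: real^3))\<^sup>2" by simp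
  then show ?thesis
    using power2_eq_iff_nonneg[of "norm (vector [r * cos p, r * sin p, z] :: real^3)" 1] by simp
qed

lemma polar_coordinates:
  obtains r p z where "r \<ge> 0" "(u :: real^3) = vector [r * cos p, r * sin p, z]"
proof -
  obtain r p where "r \<ge> 0" "Complex (u$1) (u$2) = rcis r p"
    using rcis_Ex[of "Complex (u$1) (u$2)"] by (metis norm_ge_zero rcis_cmod_Arg)
  then show ?thesis
    by (intro that[of r p "u$3"]) (auto simp: vec_eq_iff forall_3 complex_eq_iff)
qed

lemma clips_eq_isotropy:
  assumes m: "m > 0"
  shows "clips (conj_class O2_minus) (conj_class (plus_Z2c (D_rot m))) =
    insert (conj_class (D_z m)) (range (\<lambda>(b, p). conj_class (isotropy m b p)))" (is "_ = ?R")
proof -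
  let ?G = "plus_Z2c (D_rot m)"
  have G: "?G \<subseteq> carrier O3"
    by (auto simp: D_rot_Z2c_eq[OF m] carrier_O3 orthogonal_rot orthogonal_flip orthogonal_uminus)
  have oblique: "stab ?G (vector [r * cos p, r * sin p, z]) = isotropy m (z = 0) p" if "r > 0" for r p z
    by (rule stab_oblique[OF m that])
  let ?S = "(\<lambda>u. conj_class (stab ?G u)) ` {u. norm u = 1}"
  have mem: "conj_class (stab ?G u) \<in> ?S" if "norm u = 1" for u
    by (rule imageI) (simp add: that)
  have mem': "conj_class (isotropy m b p) \<in> ?R" for b p
    by (rule insertI2, rule range_eqI[of _ _ "(b, p)"]) simp
  have "conj_class (stab ?G u) \<in> ?R" if u: "norm u = 1" for u
  proof -
    obtain r p z where r: "r \<ge> 0" and polar: "u = vector [r * cos p, r * sin p, z]"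
      by (rule polar_coordinates)
    show ?thesis
    proof (cases "r = 0")
      case True
      then have "z \<noteq> 0" using u norm_polar[of r p z] by (auto simp: polar)
      then show ?thesis using True stab_vertical[OF m] by (simp add: polar)
    next
      case False
      then have "stab ?G u = isotropy m (z = 0) p" using r oblique[of r p z] by (simp add: polar)
      then show ?thesis using mem' by simp
    qed
  qed
  moreover have "conj_class (D_z m) \<in> ?S"
  proof -
    have st: "stab ?G (vector [0, 0, 1]) = D_z m" using stab_vertical[OF m] by simp
    have "norm (vector [0, 0, 1] :: real^3) = 1" using norm_polar[of 0 0 1] by simp
    from mem[OF this] show ?thesis unfolding st .
  qed
  moreover have "conj_class (isotropy m b p) \<in> ?S" for b p
  proof -
    \<comment> \<open>the unit vector with azimuth \<open>p\<close> that is horizontal exactly when \<open>b\<close> holds; oblique ones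
      use the Pythagorean triple 3, 4, 5\<close>
    define r z :: real where "r = (if b then 1 else 3/5)" and "z = (if b then 0 else 4/5)"
    have "r > 0" "(z = 0) = b" by (simp_all add: r_def z_def)
    then have st: "stab ?G (vector [r * cos p, r * sin p, z]) = isotropy m b p"
      using oblique[of r p z] by simp
    have "norm (vector [r * cos p, r * sin p, z] :: real^3) = 1"
      unfolding norm_polar by (simp add: r_def z_def power2_eq_square)
    from mem[OF this] show ?thesis unfolding st .
  qed
  ultimately have "?S \<subseteq> ?R" "?R \<subseteq> ?S"
    by (auto simp only: image_subset_iff insert_subset mem_Collect_eq split_paired_all split: prod.split)
  then show ?thesis unfolding clips_O2_minus[OF G] by (rule equalityI)
qed

section \<open>Conjugacy classes of the stabilizers\<close>

text \<open>An isometry taking \<open>e3\<close> to the horizontal unit vector of azimuth \<open>p\<close>: swap the first and third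
  axes, then rotate. One family of conjugating elements serves for all the
  nontrivial stabilizers of vectors off the vertical axis.\<close>

definition tilt :: "real \<Rightarrow> real^3^3" where
  "tilt p = rot e3 p ** vector [vector [0, 0, 1], vector [0, 1, 0], vector [1, 0, 0]]"

lemma tilt_matrix: "tilt p = vector [vector [0, - sin p, cos p], vector [0, cos p, sin p], vector [1, 0, 0]]"
  by (simp add: tilt_def rot_e3_matrix mat3_simps)

lemma orthogonal_tilt: "orthogonal_matrix (tilt p)"
  using sin_cos_squared_add[of p] sin_cos_squared_add2[of p]
  by (simp add: orthogonal_matrix_def tilt_matrix mat3_simps power2_eq_square)

lemma tilt_conj:
  "tilt p ** rot e3 pi ** transpose (tilt p) = flip (2 * p)"
  "tilt p ** flip 0 ** transpose (tilt p) = rot e3 pi"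
  "tilt p ** flip pi ** transpose (tilt p) = flip (2 * p + pi)"
  "tilt p ** transpose (tilt p) = mat 1"
  using sin_cos_squared_add[of p] sin_cos_squared_add2[of p]
  by (simp_all add: tilt_matrix rot_e3_matrix flip_def mat3_simps cos_double sin_double power2_eq_square)

lemma Z_rot_2: "Z_rot 2 = {mat 1, rot e3 pi}"
proof -
  have "{..<2::nat} = {0, 1}" by auto
  moreover have "Z_rot 2 = (\<lambda>j::nat. rot e3 (2 * real j * pi / real 2)) ` {..<2}"
    by (auto simp: Z_rot_def)
  ultimately show ?thesis by (simp add: rot_zero)
qed

lemma D_z_2: "D_z 2 = {mat 1, rot e3 pi, - flip 0, - flip pi}"
proof -
  have "flip (- pi) = flip pi" by (simp add: flip_def)
  then show ?thesis
    by (auto simp: D_z_def Z_rot_2 l_coset_def mult_O3 rot_e1_pi minus_matrix_mult flip_rot)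
qed

lemma conj_half_turn: "conj_class {mat 1, flip (2 * p)} = conj_class (Z_rot 2)"
  by (rule conj_class_eqI[OF orthogonal_tilt[of p]])
    (auto simp: Z_rot_2 tilt_conj carrier_O3 orthogonal_rot orthogonal_matrix_id)

text \<open>The mirror plane contains the azimuth \<open>p\<close>, so its normal, which is the image of \<open>e3\<close>, has azimuth
  \<open>p + pi / 2\<close>.\<close>

lemma conj_reflection: "conj_class {mat 1, - flip (2 * p + pi)} = conj_class Z2_minus"
  by (rule conj_class_eqI[OF orthogonal_tilt[of "p + pi / 2"]])
    (auto simp: Z2_minus_def tilt_conj carrier_O3 orthogonal_rot orthogonal_matrix_id orthogonal_uminus
      minus_matrix_mult matrix_mult_minus algebra_simps)

lemma conj_D_z_2:
  "conj_class {mat 1, - rot e3 pi, flip (2 * p), - flip (2 * p + pi)} = conj_class (D_z 2)"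
  by (rule conj_class_eqI[OF orthogonal_tilt[of p]])
    (auto simp: D_z_2 tilt_conj carrier_O3 orthogonal_rot orthogonal_flip orthogonal_matrix_id orthogonal_uminus
      minus_matrix_mult matrix_mult_minus)

text \<open>For even \<open>m\<close> a horizontal axis of the group is also perpendicular to another one, since \<open>angles m\<close>
  is invariant under adding \<open>pi\<close>: half-turn and vertical mirror occur at the same azimuths.\<close>

lemma isotropy_even:
  assumes "m > 0" "even m"
  shows "conj_class (isotropy m b p) =
    (if 2 * p \<in> angles m then if b then conj_class (D_z 2) else conj_class Z2_minus
     else if b then conj_class Z2_minus else conj_class triv)"
proof -
  have "pi \<in> angles m" using assms by (simp add: pi_in_angles_iff)
  moreover from this have "2 * p + pi \<in> angles m \<longleftrightarrow> 2 * p \<in> angles m"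
    using angles_add[of "2 * p" m pi] angles_diff[of "2 * p + pi" m pi] by auto
  ultimately show ?thesis
    using conj_D_z_2[of p] conj_reflection[of p]
    by (simp add: isotropy_def Z2_minus_def triv_def insert_commute)
qed

text \<open>For odd \<open>m\<close> no two horizontal axes of the group are perpendicular, as their doubled angles would
  differ by \<open>pi\<close>: half-turn and vertical mirror never occur at the same azimuth.\<close>

lemma isotropy_odd:
  assumes "m > 0" "odd m"
  shows "conj_class (isotropy m b p) =
    (if 2 * p + pi \<in> angles m then conj_class Z2_minus
     else if b \<and> 2 * p \<in> angles m then conj_class (Z_rot 2) else conj_class triv)"
proof -
  have "pi \<notin> angles m" using assms by (simp add: pi_in_angles_iff)
  moreover from this have "\<not> (2 * p + pi \<in> angles m \<and> 2 * p \<in> angles m)"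
    using angles_diff[of "2 * p + pi" m "2 * p"] by auto
  ultimately show ?thesis
    using conj_half_turn[of p] conj_reflection[of p]
    by (auto simp: isotropy_def triv_def insert_commute)
qed

theorem lemma4p27:
  fixes m :: nat
  assumes "m \<ge> 2"
  shows "clips (conj_class O2_minus) (conj_class (plus_Z2c (D_rot m))) =
    (if even m
     then {conj_class triv, conj_class Z2_minus, conj_class (D_z 2), conj_class (D_z m)}
     else {conj_class triv, conj_class (Z_rot 2), conj_class Z2_minus, conj_class (D_z m)})"
proof -
  have m: "m > 0" using assms by simp
  define I where "I = range (\<lambda>(b, p). conj_class (isotropy m b p))"
  have mem: "conj_class (isotropy m b p) \<in> I" for b p
    unfolding I_def by (rule range_eqI[of _ _ "(b, p)"]) simp
  have I_subset: "I \<subseteq> X" if "\<And>b p. conj_class (isotropy m b p) \<in> X" for X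
    using that by (auto simp: I_def)
  have zero: "2 * 0 \<in> angles m" using zero_in_angles by simp
  have half: "2 * (pi / (2 * m)) \<notin> angles m" using half_step_notin_angles[OF m] by simp
  have "I = {conj_class triv, conj_class Z2_minus, conj_class (D_z 2)}" if "even m"
  proof
    show "I \<subseteq> {conj_class triv, conj_class Z2_minus, conj_class (D_z 2)}"
      by (rule I_subset) (simp add: isotropy_even[OF m that])
    have "conj_class triv \<in> I"
      using mem[of False "pi / (2 * m)"] half by (simp add: isotropy_even[OF m that])
    moreover have "conj_class Z2_minus \<in> I"
      using mem[of False 0] zero by (simp add: isotropy_even[OF m that])
    moreover have "conj_class (D_z 2) \<in> I"
      using mem[of True 0] zero by (simp add: isotropy_even[OF m that])
    ultimately show "{conj_class triv, conj_class Z2_minus, conj_class (D_z 2)} \<subseteq> I" by simp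
  qed
  moreover have "I = {conj_class triv, conj_class (Z_rot 2), conj_class Z2_minus}" if "odd m"
  proof
    \<comment> \<open>azimuth 0 is a half-turn axis, hence off all vertical mirrors; these include azimuth \<open>- pi / 2\<close>\<close>
    have pi: "pi \<notin> angles m" using that m by (simp add: pi_in_angles_iff)
    show "I \<subseteq> {conj_class triv, conj_class (Z_rot 2), conj_class Z2_minus}"
      by (rule I_subset) (simp add: isotropy_odd[OF m that])
    have "conj_class triv \<in> I"
      using mem[of False 0] pi by (simp add: isotropy_odd[OF m that])
    moreover have "conj_class (Z_rot 2) \<in> I"
      using mem[of True 0] zero pi by (simp add: isotropy_odd[OF m that])
    moreover have "conj_class Z2_minus \<in> I"
      using mem[of False "- pi / 2"] zero by (simp add: isotropy_odd[OF m that])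
    ultimately show "{conj_class triv, conj_class (Z_rot 2), conj_class Z2_minus} \<subseteq> I" by simp
  qed
  moreover have "clips (conj_class O2_minus) (conj_class (plus_Z2c (D_rot m))) = insert (conj_class (D_z m)) I"
    unfolding I_def by (rule clips_eq_isotropy[OF m])
  ultimately show ?thesis by (simp add: insert_commute)
qed

end
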